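(* Let $\mathcal{T}$ be a complete infinitely distributive lattice with a De Morgan complement, let $P$ be an annotated revision program over a set of atoms $U$ with annotations in $\mathcal{T}$, and let the $\mathcal{T}^2$-valuation $B_I$ be a model of $P$. Let $B_R$ be a $P$-justified revision of $B_I$. Then $B_R\le_k B_I$.
   Context: Lattice: $\mathcal{T}$ is a complete lattice with order $\le$, operations $\wedge,\vee$, bottom $\bot$, top $\top$, satisfying both infinite distributive laws ($a\vee\bigwedge S=\bigwedge_{s\in S}(a\vee s)$ and $a\wedge\bigvee S=\bigvee_{s\in S}(a\wedge s)$), with a De Morgan complement $\alpha\mapsto\overline{\alpha}$ (an order-reversing involution). Programs: $U$ is a set of atoms. Revision atoms are the formal expressions $\mathbf{in}(a)$, $\mathbf{out}(a)$, $a\in U$. An annotated revision atom is $(l:\alpha)$ with $l$ a revision atom and $\alpha\in\mathcal{T}$. An annotated revision rule is $p\leftarrow q_1,\dots,q_n$ ($n\ge 0$) with $p$ (head) and $q_1,\dots,q_n$ (body) annotated revision atoms. An annotated revision program is a set of such rules. Valuations: $\mathcal{T}^2=\mathcal{T}\times\mathcal{T}$ is ordered by $\langle\alpha_1,\beta_1\rangle\le_k\langle\alpha_2,\beta_2\rangle$ iff $\alpha_1\le\alpha_2$ and $\beta_1\le\beta_2$; its meet and join are $\otimes,\oplus$. Conflation is $-\langle\alpha,\beta\rangle=\langle\overline{\beta},\overline{\alpha}\rangle$. A $\mathcal{T}^2$-valuation is a map $B:U\to\mathcal{T}^2$; $\le_k,\otimes,\oplus,-$ are extended pointwise. If $B(a)=\langle\alpha,\beta\rangle$,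 write $B[\mathbf{in}(a)]=\alpha$, $B[\mathbf{out}(a)]=\beta$. $B$ satisfies $(l:\alpha)$ if $\alpha\le B[l]$, and satisfies a body if it satisfies each of its members. $B$ is a model of $P$ if, for every rule of $P$, $B$ satisfies the head whenever it satisfies the body. Operator and necessary change: $T_P^b(B)$ is the $\mathcal{T}^2$-valuation with $T_P^b(B)[l]=\bigvee\{\alpha : (l:\alpha)$ is the head of a rule of $P$ whose body is satisfied by $B\}$ for each revision atom $l$. It is $\le_k$-monotone; its least fixpoint is the necessary change $NC(P)$. Justified revisions: $\mathit{pcomp}(\alpha,\beta)$ is the least $\gamma\in\mathcal{T}$ with $\alpha\vee\gamma\ge\beta$. The reduct $P_{B_R}|B_I$ is obtained from $P$ by (1) removing every rule whose body contains an annotated revision atom not satisfied by $B_R$, and (2) replacing each $(l:\beta)$ in the body of each remaining rule by $(l:\mathit{pcomp}(B_I[l],\beta))$. $B_R$ is a $P$-justified revision of $B_I$ if $B_R=(B_I\otimes -C)\oplus C$ where $C=NC(P_{B_R}|B_I)$. *)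

theory Defs
  imports "HOL-Library.Product_Order"
begin

text \<open>
  The library class \<open>complete_distrib_lattice\<close> demands complete distributivity, i.e. arbitrary
  meets of arbitrary joins, which is stronger than the two infinite distributive laws below.
\<close>

class de_morgan_lattice = complete_lattice +
  fixes dm_compl :: "'a \<Rightarrow> 'a"
  assumes sup_Inf_distrib: "sup a (Inf S) = (INF s\<in>S. sup a s)"
    and inf_Sup_distrib: "inf a (Sup S) = (SUP s\<in>S. inf a s)"
    and dm_compl_antimono: "a \<le> b \<Longrightarrow> dm_compl b \<le> dm_compl a"
    and dm_compl_involution: "dm_compl (dm_compl a) = a"

text \<open>
  The set of atoms is the type \<^typ>\<open>'u\<close>, the lattice of annotations is the type \<^typ>\<open>'t\<close>.
\<close>

datatype 'u rev_atom = In 'u | Out 'u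

type_synonym ('u, 't) ann_atom = "'u rev_atom \<times> 't"

datatype ('u, 't) ann_rule =
  Rule (head: "('u, 't) ann_atom") (body: "('u, 't) ann_atom list")

type_synonym ('u, 't) ann_program = "('u, 't) ann_rule set"

text \<open>
  For valuations, the order \<open>\<le>\<^sub>k\<close>, the meet \<open>\<otimes>\<close> and the join \<open>\<oplus>\<close> are the library's \<open>\<le>\<close>,
  \<^const>\<open>inf\<close> and \<^const>\<open>sup\<close> on functions into a product, both taken componentwise.
\<close>

type_synonym ('u, 't) valuation = "'u \<Rightarrow> 't \<times> 't"

definition conflation :: "('u, 't::de_morgan_lattice) valuation \<Rightarrow> ('u, 't) valuation" where
  "conflation B = (\<lambda>a. (dm_compl (snd (B a)), dm_compl (fst (B a))))"

fun val :: "('u, 't) valuation \<Rightarrow> 'u rev_atom \<Rightarrow> 't" where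
  "val B (In a) = fst (B a)"
| "val B (Out a) = snd (B a)"

definition sat_atom :: "('u, 't::ord) valuation \<Rightarrow> ('u, 't) ann_atom \<Rightarrow> bool" where
  "sat_atom B q \<longleftrightarrow> snd q \<le> val B (fst q)"

definition sat_body :: "('u, 't::ord) valuation \<Rightarrow> ('u, 't) ann_rule \<Rightarrow> bool" where
  "sat_body B r \<longleftrightarrow> (\<forall>q\<in>set (body r). sat_atom B q)"

definition is_model :: "('u, 't::ord) valuation \<Rightarrow> ('u, 't) ann_program \<Rightarrow> bool" where
  "is_model B P \<longleftrightarrow> (\<forall>r\<in>P. sat_body B r \<longrightarrow> sat_atom B (head r))"

definition derived ::
  "('u, 't::complete_lattice) ann_program \<Rightarrow> ('u, 't) valuation \<Rightarrow> 'u rev_atom \<Rightarrow> 't" where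
  "derived P B l = Sup {\<alpha>. \<exists>r\<in>P. head r = (l, \<alpha>) \<and> sat_body B r}"

definition TPb ::
  "('u, 't::complete_lattice) ann_program \<Rightarrow> ('u, 't) valuation \<Rightarrow> ('u, 't) valuation" where
  "TPb P B = (\<lambda>a. (derived P B (In a), derived P B (Out a)))"

lemma val_TPb: "val (TPb P B) l = derived P B l"
  by (cases l) (simp_all add: TPb_def)

lemma valuation_le_iff: "B \<le> B' \<longleftrightarrow> (\<forall>l. val B l \<le> val B' l)"
proof
  assume "B \<le> B'"
  then have "fst (B a) \<le> fst (B' a)" "snd (B a) \<le> snd (B' a)" for a
    by (simp_all add: le_fun_def less_eq_prod_def)
  then show "\<forall>l. val B l \<le> val B' l"
    by (metis rev_atom.exhaust val.simps)
next
  assume "\<forall>l. val B l \<le> val B' l"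
  then show "B \<le> B'"
    by (metis le_funI less_eq_prod_def val.simps)
qed

lemma sat_body_mono:
  fixes B B' :: "('u, 't::order) valuation"
  shows "B \<le> B' \<Longrightarrow> sat_body B r \<Longrightarrow> sat_body B' r"
  unfolding sat_body_def sat_atom_def valuation_le_iff by (meson order_trans)

lemma mono_TPb: "mono (TPb P)"
proof (rule monoI)
  fix B B' :: "('a, 'b) valuation"
  assume "B \<le> B'"
  then show "TPb P B \<le> TPb P B'"
    unfolding valuation_le_iff[of "TPb P B"] val_TPb derived_def
    by (blast intro: Sup_subset_mono sat_body_mono)
qed

definition NC :: "('u, 't::complete_lattice) ann_program \<Rightarrow> ('u, 't) valuation" where
  "NC P = lfp (TPb P)"

definition pcomp :: "'t::complete_lattice \<Rightarrow> 't \<Rightarrow> 't" where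
  "pcomp \<alpha> \<beta> = (LEAST \<gamma>. \<beta> \<le> sup \<alpha> \<gamma>)"

text \<open>
  The least element in the definition of \<^const>\<open>pcomp\<close> exists because of infinite distributivity.
\<close>

lemma pcomp_exists:
  fixes \<alpha> \<beta> :: "'t::de_morgan_lattice"
  shows "\<beta> \<le> sup \<alpha> (Inf {\<gamma>. \<beta> \<le> sup \<alpha> \<gamma>})"
  by (auto simp: sup_Inf_distrib intro: INF_greatest)

lemma pcomp_le_iff:
  fixes \<alpha> \<beta> \<gamma> :: "'t::de_morgan_lattice"
  shows "pcomp \<alpha> \<beta> \<le> \<gamma> \<longleftrightarrow> \<beta> \<le> sup \<alpha> \<gamma>"
proof -
  have "pcomp \<alpha> \<beta> = Inf {\<gamma>. \<beta> \<le> sup \<alpha> \<gamma>}"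
    unfolding pcomp_def by (rule Least_equality) (auto simp: pcomp_exists intro: Inf_lower)
  then show ?thesis
    using pcomp_exists[of \<beta> \<alpha>] by (metis Inf_lower mem_Collect_eq order_trans sup_mono order_refl)
qed

definition reduct ::
  "('u, 't::complete_lattice) ann_program \<Rightarrow> ('u, 't) valuation \<Rightarrow> ('u, 't) valuation
    \<Rightarrow> ('u, 't) ann_program" where
  "reduct P B\<^sub>R B\<^sub>I =
    {Rule (head r) (map (\<lambda>(l, \<beta>). (l, pcomp (val B\<^sub>I l) \<beta>)) (body r)) | r. r \<in> P \<and> sat_body B\<^sub>R r}"

definition justified_revision ::
  "('u, 't::de_morgan_lattice) ann_program \<Rightarrow> ('u, 't) valuation \<Rightarrow> ('u, 't) valuation
    \<Rightarrow> bool" where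
  "justified_revision P B\<^sub>I B\<^sub>R \<longleftrightarrow>
    (let C = NC (reduct P B\<^sub>R B\<^sub>I) in B\<^sub>R = sup (inf B\<^sub>I (conflation C)) C)"

end

theory Submission
  imports Defs
begin

text \<open>In a model, every annotation joined in \<open>derived P B l\<close> is the head of a
  fired rule, hence at most \<open>val B l\<close>. So a model is a pre-fixpoint of
  \<open>TPb P\<close>, and \<open>lfp\<close> lies below all of these.\<close>

lemma NC_le_model:
  fixes P :: "('u, 't::complete_lattice) ann_program"
  assumes "is_model B P"
  shows "NC P \<le> B"
proof -
  have "derived P B l \<le> val B l" for l
    unfolding derived_def using assms
    by (force intro!: Sup_least simp: is_model_def sat_atom_def)
  then have "TPb P B \<le> B"
    by (simp add: valuation_le_iff val_TPb)
  then show ?thesis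
    unfolding NC_def by (rule lfp_lowerbound)
qed

text \<open>
  A body atom weakened by \<^const>\<open>pcomp\<close> relative to \<open>B\<close> holds in \<open>B\<close> only if the original atom
  does, since \<open>pcomp \<alpha> \<beta> \<le> \<alpha>\<close> amounts to \<open>\<beta> \<le> sup \<alpha> \<alpha>\<close>.
\<close>

lemma is_model_reduct:
  fixes P :: "('u, 't::de_morgan_lattice) ann_program"
  assumes "is_model B P"
  shows "is_model B (reduct P B' B)"
  using assms
  by (fastforce simp: is_model_def reduct_def sat_body_def sat_atom_def pcomp_le_iff)

theorem theorem5p10:
  fixes P :: "('u, 't::de_morgan_lattice) ann_program"
    and B\<^sub>I B\<^sub>R :: "('u, 't) valuation"
  assumes "is_model B\<^sub>I P"
    and "justified_revision P B\<^sub>I B\<^sub>R"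
  shows "B\<^sub>R \<le> B\<^sub>I"
proof -
  define C where "C = NC (reduct P B\<^sub>R B\<^sub>I)"
  have "C \<le> B\<^sub>I"
    unfolding C_def using assms(1) by (intro NC_le_model is_model_reduct)
  moreover have "B\<^sub>R = sup (inf B\<^sub>I (conflation C)) C"
    using assms(2) by (simp add: justified_revision_def C_def Let_def)
  \<comment> \<open>Both joinands lie below \<open>B\<^sub>I\<close>: the first as a meet with
    \<open>B\<^sub>I\<close>, the second by the bound on \<open>C\<close>.\<close>
  ultimately show ?thesis
    by simp
qed

end
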